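(* Let $m,k\in\mathbb Z^+$ with $k\geqslant m$, let $a_1,\ldots,a_k\in\mathbb Z$ and $n_1\leqslant n_2\leqslant\cdots\leqslant n_k$ be positive integers, and suppose $\{a_s(n_s)\}_{s=1}^k$ is an $m$-system, i.e. every $x\in\mathbb Z$ satisfies $|\{1\leqslant s\leqslant k: x\equiv a_s\pmod{n_s}\}|\leqslant m$. Suppose $\sum_{s=1}^k1/n_s\neq m$. Then $$\sum_{s=1}^k\frac1{n_s}\leqslant m-\frac1{2^{k-m+1}},$$ and equality holds if and only if $n_s=2^{\max\{s-m+1,0\}}$ for all $s=1,\ldots,k$.
   Context: $a(n)=\{x\in\mathbb Z:x\equiv a\pmod n\}$. *)

theory Defs
  imports Complex_Main "HOL-Number_Theory.Cong"
begin

definition residue_class :: "int \<Rightarrow> nat \<Rightarrow> int set" where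
  "residue_class a n = {x. [x = a] (mod int n)}"

text \<open>Systems are indexed by \<open>{1..k}\<close>; values of \<open>a\<close> and \<open>n\<close> at other indices are irrelevant.
  Residue classes are counted with multiplicity, by index.\<close>

definition m_system :: "nat \<Rightarrow> nat \<Rightarrow> (nat \<Rightarrow> int) \<Rightarrow> (nat \<Rightarrow> nat) \<Rightarrow> bool" where
  "m_system m k a n \<longleftrightarrow>
     (\<forall>x. card {s \<in> {1..k}. x \<in> residue_class (a s) (n s)} \<le> m)"

end

theory Submission
  imports Defs "HOL-Library.Real_Mod" "HOL-Computational_Algebra.Polynomial"
begin

text \<open>Write \<open>L = k - m + 1\<close>, \<open>T = 2 ^ L\<close> and let \<open>w x\<close> count the classes containing \<open>x\<close>. Any \<open>L\<close> classes
  cover all integers once they cover \<open>T\<close> consecutive ones, since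
  \<open>\<Prod>s. 1 - exp (2 \<pi> \<i> (x - a s) / n s)\<close> is a sum of \<open>T\<close> exponentials in \<open>x\<close>. Hence \<open>w < m\<close> somewhere
  in every window of length \<open>T\<close>, so \<open>m - w\<close> has density at least \<open>1 / T\<close>.

  In the case of equality \<open>m - w\<close> is the indicator of a class \<open>b mod T\<close>. Encoding multiplicities as
  orders of zeros at \<open>N\<close>-th roots of unity gives
  \<open>(\<Prod>s. 1 - e s X ^ (N / n s)) = (1 - X ^ N) ^ (m - 1) * (\<Sum>r<T. (e X ^ (N / T)) ^ r)\<close>
  with all \<open>e s\<close> and \<open>e\<close> of modulus 1. The absolute values of the coefficients on the right sum to
  \<open>2 ^ (m - 1) * T = 2 ^ k\<close>, the number of terms on the left, so nothing cancels on the left and the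
  identity survives with all signs and phases removed; it then determines the \<open>n s\<close>.\<close>

section \<open>Roots of unity and residue classes\<close>

definition unit_root :: "nat \<Rightarrow> int \<Rightarrow> complex" where
  "unit_root n x = cis (2 * pi * of_int x / of_nat n)"

lemma unit_root_add: "unit_root n (x + y) = unit_root n x * unit_root n y"
  by (simp add: unit_root_def cis_mult add_divide_distrib algebra_simps)

lemma unit_root_power: "unit_root n x ^ j = unit_root n (int j * x)"
  by (simp add: unit_root_def DeMoivre algebra_simps)

lemma norm_unit_root [simp]: "norm (unit_root n x) = 1"
  by (simp add: unit_root_def)

lemma unit_root_scale: "d > 0 \<Longrightarrow> unit_root (n * d) (int d * x) = unit_root n x"
  by (simp add: unit_root_def field_simps)

lemma unit_root_eq_1_iff:
  assumes "n > 0"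
  shows "unit_root n x = 1 \<longleftrightarrow> int n dvd x"
proof -
  have "unit_root n x = 1 \<longleftrightarrow> (\<exists>j. 2 * pi * of_int x / of_nat n = of_int j * (2 * pi))"
    by (simp add: unit_root_def cis_eq_1_iff)
  also have "\<dots> \<longleftrightarrow> (\<exists>j. real_of_int x = of_int (int n * j))"
    using assms by (auto simp: field_simps)
  also have "\<dots> \<longleftrightarrow> int n dvd x"
    unfolding of_int_eq_iff dvd_def by simp
  finally show ?thesis .
qed

lemma mem_residue_class_iff: "x \<in> residue_class a n \<longleftrightarrow> int n dvd x - a"
  by (simp add: residue_class_def cong_iff_dvd_diff)

text \<open>Both sides are polynomials in \<open>z\<close> of degree at most \<open>d\<close> that
  agree at \<open>d + 1\<close> points: the \<open>d\<close>-th roots of unity and 0.\<close>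

lemma prod_one_minus_unit_root:
  assumes "d > 0"
  shows "(\<Prod>j<d. 1 - unit_root d (int j) * z) = 1 - z ^ d"
proof -
  let ?p = "\<Prod>j<d. [:1, - unit_root d (int j):]" and ?q = "1 - monom 1 d :: complex poly"
  let ?A = "insert 0 {z :: complex. z ^ d = 1}"
  have card: "card ?A = Suc d"
    using assms by (simp add: card_roots_unity_eq finite_roots_unity card_insert_if power_0_left)
  have "?p = ?q"
  proof (rule poly_eqI_degree)
    fix z :: complex assume "z \<in> ?A"
    then consider "z = 0" | "z ^ d = 1" by blast
    then show "poly ?p z = poly ?q z"
    proof cases
      case 1
      then show ?thesis using assms by (simp add: poly_prod poly_monom)
    next
      case 2
      \<comment> \<open>The factor with root \<open>z\<close> carries the coefficient
        \<open>inverse z\<close>, so it is the inverse that is located among the roots of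
        unity.\<close>
      then have "inverse z ^ d = 1" by (simp add: power_inverse)
      then have "inverse z \<in> (\<lambda>k. cis (2 * pi * real k / real d)) ` {..<d}"
        using bij_betw_roots_unity[OF assms] by (auto simp: bij_betw_def)
      then obtain j where j: "j < d" "inverse z = unit_root d (int j)"
        by (auto simp: unit_root_def)
      have "z \<noteq> 0" using 2 assms by (auto simp: power_0_left)
      then have "1 - unit_root d (int j) * z = 0" using j(2)[symmetric] by simp
      then have "poly ?p z = 0" using j(1)
        by (auto simp: poly_prod prod_zero_iff mult.commute intro!: bexI[of _ j])
      then show ?thesis using 2 by (simp add: poly_monom)
    qed
  next
    have "degree ?p \<le> (\<Sum>j<d. 1)"
      by (rule order_trans[OF degree_prod_sum_le], simp, rule sum_mono) simp
    then show "degree ?p < card ?A" by (simp add: card)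
    have "degree ?q \<le> d" by (rule degree_diff_le) (simp_all add: degree_monom_le)
    then show "degree ?q < card ?A" by (simp add: card)
  qed
  then have "poly ?p z = poly ?q z" by simp
  then show ?thesis by (simp add: poly_prod poly_monom mult.commute)
qed

lemma residue_class_initial_segment:
  assumes "n > 0"
  shows "{x \<in> {..<n * d}. int x \<in> residue_class a n} = (\<lambda>j. nat (a mod int n) + n * j) ` {..<d}"
    (is "?S = ?f ` _")
proof (intro equalityI subsetI)
  fix x assume x: "x \<in> ?S"
  let ?r = "nat (a mod int n)"
  have "int x mod int n = a mod int n" using x by (simp add: residue_class_def cong_def)
  then have r: "?r = x mod n" by (metis nat_int zmod_int)
  have "x = ?f (x div n)" unfolding r by simp
  moreover have "x div n < d"
    using x assms by (simp add: div_less_iff_less_mult mult.commute)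
  ultimately show "x \<in> ?f ` {..<d}" by blast
next
  fix x assume "x \<in> ?f ` {..<d}"
  then obtain j where j: "j < d" "x = ?f j" by auto
  have r: "nat (a mod int n) < n" using assms by (simp add: nat_less_iff)
  have "x < n * Suc j" using j r by simp
  also have "\<dots> \<le> n * d" using j by (intro mult_le_mono2) simp
  finally have "x < n * d" .
  moreover have "int x mod int n = a mod int n" using j assms by simp
  ultimately show "x \<in> ?S" by (simp add: residue_class_def cong_def)
qed

lemma inj_add_mult_nat: "n > 0 \<Longrightarrow> inj_on (\<lambda>j. r + n * j :: nat) A"
  by (auto simp: inj_on_def)

lemma card_residue_class_initial_segment:
  assumes "n > 0"
  shows "card {x \<in> {..<n * d}. int x \<in> residue_class a n} = d"
  unfolding residue_class_initial_segment[OF assms]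
  by (simp add: card_image inj_add_mult_nat[OF assms])

lemma unit_root_mod: "n > 0 \<Longrightarrow> unit_root n (a mod int n) = unit_root n a"
proof -
  assume n: "n > 0"
  have "unit_root n a = unit_root n (a mod int n + int n * (a div int n))" by simp
  also have "\<dots> = unit_root n (a mod int n)"
    unfolding unit_root_add using unit_root_eq_1_iff[OF n] by simp
  finally show ?thesis by simp
qed

text \<open>Writing \<open>x\<close> as least residue plus \<open>n * j\<close> splits its root of
  unity into a fixed phase times \<open>unit_root d j\<close>, and the product over \<open>j\<close>
  collapses. This translates residue classes into factors of
  \<open>1 - monom 1 (n * d)\<close>.\<close>

lemma prod_linear_residue_class:
  assumes "n > 0" "d > 0"
  shows "(\<Prod>x\<in>{x \<in> {..<n * d}. int x \<in> residue_class a n}. [:1, - unit_root (n * d) (int x):])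
         = 1 - monom (unit_root n a) d"
proof -
  let ?r = "nat (a mod int n)"
  have "poly (\<Prod>x\<in>{x \<in> {..<n * d}. int x \<in> residue_class a n}. [:1, - unit_root (n * d) (int x):]) z
        = poly (1 - monom (unit_root n a) d) z" for z
  proof -
    have eq: "unit_root (n * d) (int (?r + n * j)) = unit_root (n * d) ?r * unit_root d j" for j
      using unit_root_scale[of n d "int j"] assms by (simp add: unit_root_add mult.commute)
    have "poly (\<Prod>x\<in>{x \<in> {..<n * d}. int x \<in> residue_class a n}. [:1, - unit_root (n * d) (int x):]) z
        = (\<Prod>j<d. 1 - unit_root (n * d) (int (?r + n * j)) * z)"
      unfolding residue_class_initial_segment[OF assms(1)]
        prod.reindex[OF inj_add_mult_nat[OF assms(1)]] poly_prod
      by (simp add: mult.commute[of z])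
    also have "\<dots> = (\<Prod>j<d. 1 - unit_root d j * (unit_root (n * d) ?r * z))"
      unfolding eq by (simp add: mult_ac)
    also have "\<dots> = 1 - (unit_root (n * d) ?r * z) ^ d"
      by (rule prod_one_minus_unit_root[OF assms(2)])
    also have "unit_root (n * d) ?r ^ d = unit_root n a"
      using assms by (simp add: unit_root_power unit_root_scale unit_root_mod)
    then have "1 - (unit_root (n * d) ?r * z) ^ d = poly (1 - monom (unit_root n a) d) z"
      by (simp add: power_mult_distrib poly_monom)
    finally show ?thesis .
  qed
  then show ?thesis by (simp add: poly_eq_poly_eq_iff[symmetric] fun_eq_iff)
qed

section \<open>Exponential sums and covering of consecutive integers\<close>

text \<open>The values obey the linear recurrence whose characteristic polynomial is the monic
  \<open>p\<close> with roots \<open>\<Lambda> i\<close>. Unlike a Vandermonde argument, this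
  tolerates coincidences among the \<open>\<Lambda> i\<close>, which can occur for products over
  subsets.\<close>

lemma exponential_sum_recurrence:
  fixes c \<Lambda> :: "'i \<Rightarrow> 'a::comm_ring_1"
  assumes "finite K" and "\<And>j. j < card K \<Longrightarrow> (\<Sum>i\<in>K. c i * \<Lambda> i ^ (y + j)) = 0"
  shows "(\<Sum>i\<in>K. c i * \<Lambda> i ^ (y + card K)) = 0"
proof -
  define p where "p = (\<Prod>i\<in>K. [:- \<Lambda> i, 1:])"
  have lead: "coeff p (card K) = 1 \<and> degree p \<le> card K"
    unfolding p_def using assms(1)
  proof (induction K)
    case (insert i K)
    then have "coeff (\<Prod>i\<in>K. [:- \<Lambda> i, 1:]) (Suc (card K)) = 0" by (intro coeff_eq_0) simp
    moreover have "degree ([:- \<Lambda> i, 1:] * (\<Prod>i\<in>K. [:- \<Lambda> i, 1:])) \<le> Suc (card K)"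
      using insert by (intro order_trans[OF degree_mult_le]) simp
    ultimately show ?case using insert by (simp add: coeff_pCons)
  qed simp
  have root: "poly p (\<Lambda> i) = 0" if "i \<in> K" for i
    unfolding p_def poly_prod by (rule prod_zero[OF assms(1)]) (use that in auto)
  have pe: "poly p x = (\<Sum>j\<le>card K. coeff p j * x ^ j)" for x
    unfolding poly_altdef using lead
    by (intro sum.mono_neutral_left) (auto simp: coeff_eq_0)
  have "0 = (\<Sum>i\<in>K. c i * \<Lambda> i ^ y * poly p (\<Lambda> i))" by (simp add: root)
  also have "\<dots> = (\<Sum>j\<le>card K. coeff p j * (\<Sum>i\<in>K. c i * \<Lambda> i ^ (y + j)))"
    unfolding pe sum_distrib_left by (subst sum.swap) (simp add: power_add mult_ac)
  also have "\<dots> = coeff p (card K) * (\<Sum>i\<in>K. c i * \<Lambda> i ^ (y + card K))"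
    by (simp add: lessThan_Suc_atMost[symmetric] assms(2))
  finally show ?thesis using lead by simp
qed

lemma exponential_sum_vanishes:
  fixes c \<Lambda> :: "'i \<Rightarrow> 'a::comm_ring_1"
  assumes "finite K" and "\<And>j. j < card K \<Longrightarrow> (\<Sum>i\<in>K. c i * \<Lambda> i ^ j) = 0"
  shows "(\<Sum>i\<in>K. c i * \<Lambda> i ^ x) = 0"
proof (induction x rule: less_induct)
  case (less x)
  show ?case
  proof (cases "x < card K")
    case False
    have "(\<Sum>i\<in>K. c i * \<Lambda> i ^ (x - card K + card K)) = 0"
      by (rule exponential_sum_recurrence[OF assms(1)]) (use less False in simp)
    then show ?thesis using False by simp
  qed (use assms in simp)
qed

text \<open>Multiplied out over the subsets of \<open>J\<close>, the product \<open>F\<close> has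
  \<open>2 ^ card J\<close> exponential terms, and that many consecutive zeros force it to
  vanish.\<close>

lemma covers_nat_if_covers_initial_segment:
  assumes J: "finite J" and n: "\<And>s. s \<in> J \<Longrightarrow> n s > 0"
    and cover: "\<And>x. x < 2 ^ card J \<Longrightarrow> \<exists>s\<in>J. int x \<in> residue_class (a s) (n s)"
  shows "\<exists>s\<in>J. int x \<in> residue_class (a s) (n s)"
proof -
  define F where "F x = (\<Prod>s\<in>J. - unit_root (n s) (- a s) * unit_root (n s) 1 ^ x + 1)" for x :: nat
  have F0: "F x = 0 \<longleftrightarrow> (\<exists>s\<in>J. int x \<in> residue_class (a s) (n s))" for x
  proof -
    have "- unit_root (n s) (- a s) * unit_root (n s) 1 ^ x + 1 = 0
          \<longleftrightarrow> int x \<in> residue_class (a s) (n s)" if "s \<in> J" for s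
    proof -
      have "unit_root (n s) (- a s) * unit_root (n s) 1 ^ x = unit_root (n s) (int x - a s)"
        using unit_root_add[of "n s" "- a s" "int x"] by (simp add: unit_root_power)
      then show ?thesis
        using unit_root_eq_1_iff[OF n[OF that], of "int x - a s"] by (auto simp: mem_residue_class_iff)
    qed
    then show ?thesis unfolding F_def using J by (simp add: prod_zero_iff)
  qed
  define c where "c I = (\<Prod>s\<in>I. - unit_root (n s) (- a s))" for I
  define \<Lambda> where "\<Lambda> I = (\<Prod>s\<in>I. unit_root (n s) 1)" for I
  have F: "F x = (\<Sum>I\<in>Pow J. c I * \<Lambda> I ^ x)" for x
    unfolding F_def prod_add[OF J] c_def \<Lambda>_def
    by (simp only: prod.distrib prod_power_distrib prod.neutral_const mult_1_right)
  have "(\<Sum>I\<in>Pow J. c I * \<Lambda> I ^ x) = 0"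
  proof (rule exponential_sum_vanishes)
    show "finite (Pow J)" using J by simp
    fix j assume "j < card (Pow J)"
    then show "(\<Sum>I\<in>Pow J. c I * \<Lambda> I ^ j) = 0"
      using cover[of j] F0[of j] F[of j] J by (simp add: card_Pow)
  qed
  then show ?thesis using F0[of x] F[of x] by simp
qed

section \<open>Coefficient bounds and products without overlapping terms\<close>

lemma coeff_mult_majorant:
  fixes p q :: "complex poly" and p' q' :: "real poly"
  assumes "\<And>t. norm (coeff p t) \<le> coeff p' t" and "\<And>t. norm (coeff q t) \<le> coeff q' t"
  shows "norm (coeff (p * q) t) \<le> coeff (p' * q') t"
proof -
  have nonneg: "coeff p' t \<ge> 0" for t by (rule order_trans[OF norm_ge_zero assms(1)])
  have "norm (coeff (p * q) t) \<le> (\<Sum>i\<le>t. norm (coeff p i) * norm (coeff q (t - i)))"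
    unfolding coeff_mult norm_mult[symmetric] by (rule norm_sum)
  also have "\<dots> \<le> coeff (p' * q') t"
    unfolding coeff_mult by (intro sum_mono mult_mono assms nonneg norm_ge_zero)
  finally show ?thesis .
qed

lemma coeff_prod_one_minus_monom_majorant:
  assumes "finite S" and "\<And>s. s \<in> S \<Longrightarrow> norm (e s) = 1"
  shows "norm (coeff (\<Prod>s\<in>S. 1 - monom (e s :: complex) (d s)) t)
         \<le> coeff (\<Prod>s\<in>S. 1 + monom 1 (d s) :: real poly) t"
  using assms
proof (induction S arbitrary: t rule: finite_induct)
  case (insert s S)
  have "norm (coeff (1 - monom (e s) (d s)) t) \<le> coeff (1 + monom 1 (d s) :: real poly) t" for t
    \<comment> \<open>The triangle inequality matters when \<open>d s = 0\<close>, where both terms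
      fall on the constant coefficient.\<close>
    using insert.prems[of s] norm_triangle_ineq4[of "1::complex" "e s"] by (auto simp: coeff_1)
  then show ?case using insert by (simp add: coeff_mult_majorant)
qed (simp add: coeff_1)

text \<open>The nonnegative coefficients of \<open>q - p\<close> sum to its value at 1, which is
  0.\<close>

lemma poly_eq_if_coeff_le:
  fixes p q :: "real poly"
  assumes "\<And>t. coeff p t \<le> coeff q t" and "poly p 1 = poly q 1"
  shows "p = q"
proof -
  have "(\<Sum>t\<le>degree (q - p). coeff (q - p) t) = poly (q - p) 1" by (simp only: poly_altdef power_one mult_1_right)
  also have "\<dots> = 0" using assms(2) by simp
  finally have "\<forall>t\<in>{..degree (q - p)}. coeff (q - p) t = 0"
    using assms(1) by (subst (asm) sum_nonneg_eq_0_iff) auto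
  then have "q - p = 0" using leading_coeff_0_iff by blast
  then show ?thesis by simp
qed

text \<open>Division with remainder, \<open>u = i * T + r\<close>, merges the two sums into one
  whose exponents \<open>q * u\<close> are distinct for \<open>q > 0\<close>.\<close>

lemma sum_monom_mult_sum_monom:
  fixes \<alpha> \<beta> :: "nat \<Rightarrow> 'a::comm_semiring_1"
  assumes "T > 0"
  shows "(\<Sum>i<M. monom (\<alpha> i) (T * q * i)) * (\<Sum>r<T. monom (\<beta> r) (q * r))
         = (\<Sum>u<M * T. monom (\<alpha> (u div T) * \<beta> (u mod T)) (q * u))"
proof -
  have "(\<Sum>u<M * T. monom (\<alpha> (u div T) * \<beta> (u mod T)) (q * u))
    = (\<Sum>i<M. \<Sum>u\<in>{i * T..<i * T + T}. monom (\<alpha> (u div T) * \<beta> (u mod T)) (q * u))"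
    by (rule sum.nat_group[symmetric])
  also have "\<dots> = (\<Sum>i<M. \<Sum>r<T. monom (\<alpha> i * \<beta> r) (T * q * i + q * r))"
  proof (rule sum.cong[OF refl])
    fix i
    show "(\<Sum>u\<in>{i * T..<i * T + T}. monom (\<alpha> (u div T) * \<beta> (u mod T)) (q * u))
        = (\<Sum>r<T. monom (\<alpha> i * \<beta> r) (T * q * i + q * r))"
      by (rule sum.reindex_bij_witness[symmetric, of _ "\<lambda>u. u - i * T" "\<lambda>r. i * T + r"])
         (use assms in \<open>auto simp: algebra_simps\<close>)
  qed
  also have "\<dots> = (\<Sum>i<M. monom (\<alpha> i) (T * q * i)) * (\<Sum>r<T. monom (\<beta> r) (q * r))"
    by (simp add: sum_product mult_monom)
  finally show ?thesis by simp
qed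

lemma norm_coeff_sum_monom:
  assumes "q > 0" and "\<And>u. u < M \<Longrightarrow> norm (\<gamma> u :: complex) = \<gamma>' u"
  shows "norm (coeff (\<Sum>u<M. monom (\<gamma> u) (q * u)) t) = coeff (\<Sum>u<M. monom (\<gamma>' u) (q * u)) t"
proof (cases "\<exists>u<M. q * u = t")
  case True
  then obtain v where v: "v < M" "q * v = t" by blast
  then have eq: "q * u = t \<longleftrightarrow> u = v" for u using assms(1) by auto
  show ?thesis using v by (simp add: coeff_sum eq sum.delta assms(2))
next
  case False
  then show ?thesis by (simp add: coeff_sum)
qed

lemma one_plus_monom_power:
  "(1 + monom (c::'a::comm_ring_1) N) ^ M = (\<Sum>i<Suc M. monom (of_nat (M choose i) * c ^ i) (N * i))"
  unfolding add.commute[of 1] binomial_ring lessThan_Suc_atMost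
  by (simp add: monom_power of_nat_poly smult_monom)

text \<open>The exponents \<open>q * r\<close> stay below \<open>T * q\<close>, so the blocks coming
  from the binomial expansion never overlap and no cancellation can occur.\<close>

lemma norm_coeff_power_mult_geometric:
  fixes e :: complex
  assumes "norm e = 1" "q > 0" "T > 0"
  shows "norm (coeff ((1 - monom 1 (T * q)) ^ M * (\<Sum>r<T. monom (e ^ r) (q * r))) t)
    = coeff ((1 + monom 1 (T * q)) ^ M * (\<Sum>r<T. monom 1 (q * r)) :: real poly) t"
proof -
  have neg: "1 - monom 1 (T * q) = (1 + monom (-1) (T * q) :: complex poly)"
    by (simp add: minus_monom)
  show ?thesis
    unfolding neg one_plus_monom_power sum_monom_mult_sum_monom[OF assms(3)]
    by (rule norm_coeff_sum_monom) (simp_all add: assms norm_mult norm_power)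
qed

text \<open>Every \<open>r < 2 ^ L\<close> has a unique binary expansion.\<close>

lemma prod_one_plus_monom_two_power:
  "(\<Prod>i<L. 1 + monom 1 (q * 2 ^ i)) = (\<Sum>r<2 ^ L. monom (1::'a::comm_ring_1) (q * r))"
proof (induction L)
  case (Suc L)
  have "(\<Sum>r<2 ^ Suc L. monom (1::'a) (q * r)) =
     (\<Sum>i<2. monom (1::'a) (2 ^ L * q * i)) * (\<Sum>r<2 ^ L. monom 1 (q * r))"
    by (subst sum_monom_mult_sum_monom) simp_all
  also have "(\<Sum>i<2. monom (1::'a) (2 ^ L * q * i)) = 1 + monom 1 (q * 2 ^ L)"
    by (simp add: eval_nat_numeral mult.commute)
  finally show ?case using Suc by (simp add: mult.commute)
qed simp

text \<open>The largest exponent \<open>D\<close> is visible as the root \<open>exp (\<pi> \<i> / D)\<close>, at which no factor with a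
  smaller exponent vanishes.\<close>

lemma prod_one_plus_monom_sorted_inject:
  fixes D E :: "nat \<Rightarrow> nat"
  assumes "(\<Prod>i<k. 1 + monom 1 (D i)) = (\<Prod>i<k. 1 + monom 1 (E i) :: complex poly)"
    and "mono_on {..<k} D" "mono_on {..<k} E"
    and "\<And>i. i < k \<Longrightarrow> D i > 0" "\<And>i. i < k \<Longrightarrow> E i > 0"
  shows "\<forall>i<k. D i = E i"
  using assms
proof (induction k)
  case (Suc k)
  have le: "A k \<le> B k"
    if AB: "(\<Prod>i<Suc k. 1 + monom 1 (A i)) = (\<Prod>i<Suc k. 1 + monom 1 (B i) :: complex poly)"
      and B: "mono_on {..<Suc k} B" and pos: "A k > 0" for A B
  proof -
    let ?z = "cis (pi / A k)"
    have pow: "?z ^ b = cis (pi * b / A k)" for b :: nat by (simp add: DeMoivre mult.commute)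
    have "poly (\<Prod>i<Suc k. 1 + monom 1 (A i)) ?z = 0"
      using pos by (simp add: poly_monom pow)
    then have "\<exists>i\<in>{..<Suc k}. 1 + ?z ^ B i = 0"
      unfolding AB by (simp add: poly_prod poly_monom del: prod.lessThan_Suc)
    then obtain i where i: "i < Suc k" "1 + ?z ^ B i = 0" by auto
    \<comment> \<open>Otherwise the angle of \<open>?z ^ B i\<close> would lie in [0, pi), where
      cosine never takes the value -1.\<close>
    have "\<not> B i < A k"
    proof
      assume less: "B i < A k"
      have "pi * B i / A k < pi" using less pos by (simp add: divide_less_eq)
      moreover have "pi * B i / A k \<ge> 0" by simp
      moreover have "cis (pi * B i / A k) = -1" using i(2) pow by (metis add_eq_0_iff)
      then have "cos (pi * B i / A k) = cos pi" by (simp add: complex_eq_iff)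
      ultimately have "pi * B i / A k = pi" using cos_inj_pi by (metis less_imp_le order_refl pi_ge_zero)
      then show False using \<open>pi * B i / A k < pi\<close> by simp
    qed
    moreover have "B i \<le> B k" by (rule mono_onD[OF B]) (use i in auto)
    ultimately show ?thesis by simp
  qed
  have top: "D k = E k"
    using le[of D E] le[of E D] Suc.prems by (simp add: antisym)
  have "coeff (1 + monom 1 (E k) :: complex poly) (E k) \<noteq> 0" using Suc.prems(5)[of k] by (simp add: coeff_1)
  then have "(1 + monom 1 (E k) :: complex poly) \<noteq> 0" by (metis coeff_0)
  then have "(\<Prod>i<k. 1 + monom 1 (D i)) = (\<Prod>i<k. 1 + monom 1 (E i) :: complex poly)"
    using Suc.prems(1) top by simp
  then have "\<forall>i<k. D i = E i"
    using Suc.prems by (intro Suc.IH) (auto intro: mono_on_subset)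
  then show ?case using top by (simp add: less_Suc_eq)
qed simp

section \<open>Covering multiplicities\<close>

definition cover_count :: "nat \<Rightarrow> (nat \<Rightarrow> int) \<Rightarrow> (nat \<Rightarrow> nat) \<Rightarrow> int \<Rightarrow> nat" where
  "cover_count k a n x = card {s \<in> {1..k}. x \<in> residue_class (a s) (n s)}"

text \<open>Translating the system reduces a window starting at \<open>y\<close> to one starting at
  0.\<close>

lemma cover_count_shift: "cover_count k (\<lambda>s. a s - y) n x = cover_count k a n (y + x)"
proof -
  have "x - (a s - y) = y + x - a s" for s by simp
  then show ?thesis by (simp only: cover_count_def mem_residue_class_iff)
qed

text \<open>Double counting: the class of index \<open>s\<close> meets a window of length
  \<open>N\<close> in \<open>N div n s\<close> points.\<close>

lemma sum_cover_count:
  assumes "\<And>s. s \<in> {1..k} \<Longrightarrow> n s > 0" and "\<And>s. s \<in> {1..k} \<Longrightarrow> n s dvd N"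
  shows "real (\<Sum>x<N. cover_count k a n (y + int x)) = real N * (\<Sum>s=1..k. 1 / real (n s))"
proof -
  have "(\<Sum>x<N. cover_count k a n (y + int x))
      = (\<Sum>s\<in>{1..k}. card {x \<in> {..<N}. int x \<in> residue_class (a s - y) (n s)})"
    unfolding cover_count_shift[of k a y n, symmetric] unfolding cover_count_def card_eq_sum
    by (rule sum.swap_restrict) simp_all
  also have "\<dots> = (\<Sum>s\<in>{1..k}. N div n s)"
  proof (rule sum.cong[OF refl])
    fix s assume s: "s \<in> {1..k}"
    have "card {x \<in> {..<n s * (N div n s)}. int x \<in> residue_class (a s - y) (n s)} = N div n s"
      by (rule card_residue_class_initial_segment[OF assms(1)[OF s]])
    then show "card {x \<in> {..<N}. int x \<in> residue_class (a s - y) (n s)} = N div n s"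
      using assms(2)[OF s] by simp
  qed
  also have "real \<dots> = (\<Sum>s=1..k. real N * (1 / real (n s)))"
    unfolding of_nat_sum by (rule sum.cong) (simp_all add: assms real_of_nat_div)
  finally show ?thesis by (simp add: sum_distrib_left)
qed

text \<open>If fewer than \<open>m\<close> classes contain \<open>x\<close>, then some
  \<open>k - m + 1\<close> classes all miss it. Yet these cover the initial window, hence also
  \<open>x\<close>.\<close>

lemma cover_count_ge_if_initial_segment:
  assumes "m > 0" "k \<ge> m" and n: "\<And>s. s \<in> {1..k} \<Longrightarrow> n s > 0"
    and ge: "\<And>x. x < 2 ^ (k - m + 1) \<Longrightarrow> cover_count k a n (int x) \<ge> m"
  shows "cover_count k a n (int x) \<ge> m"
proof (rule ccontr)
  let ?C = "\<lambda>x. {s \<in> {1..k}. int x \<in> residue_class (a s) (n s)}"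
  assume "\<not> ?thesis"
  then have "card (?C x) < m" by (simp add: cover_count_def)
  moreover have "card ({1..k} - ?C x) = k - card (?C x)"
    by (subst card_Diff_subset) auto
  ultimately have "k - m + 1 \<le> card ({1..k} - ?C x)" using assms(1,2) by linarith
  then obtain J where J: "J \<subseteq> {1..k} - ?C x" "card J = k - m + 1" "finite J"
    by (rule obtain_subset_with_card_n)
  \<comment> \<open>Pigeonhole: \<open>k - m + 1\<close> indices in \<open>J\<close> and at least
    \<open>m\<close> containing \<open>y\<close> cannot be disjoint in
    \<open>{1..k}\<close>.\<close>
  have cover: "\<exists>s\<in>J. int y \<in> residue_class (a s) (n s)" if y: "y < 2 ^ card J" for y
  proof (rule ccontr)
    assume "\<not> ?thesis"
    then have "J \<inter> ?C y = {}" "J \<union> ?C y \<subseteq> {1..k}" using J by auto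
    then have "card J + card (?C y) \<le> card {1..k}"
      using J(3) by (metis (no_types, lifting) card_Un_disjoint card_mono finite_Un finite_atLeastAtMost finite_subset)
    then show False using ge[of y] y J(2) assms(2) by (simp add: cover_count_def)
  qed
  have "n s > 0" if "s \<in> J" for s using J(1) that by (intro n) blast
  from covers_nat_if_covers_initial_segment[OF J(3) this cover]
  have "\<exists>s\<in>J. int x \<in> residue_class (a s) (n s)" .
  then show False using J(1) by auto
qed

section \<open>Determining the moduli in the case of equality\<close>

text \<open>\<open>M\<close> stands for \<open>m - 1\<close>. At 1 both phase-free products equal
  \<open>2 ^ k\<close>, so the coefficientwise bound between them is an identity, from which the
  sorted exponents are read off.\<close>

lemma moduli_of_cover_missing_two_power_class:
  assumes n: "\<And>s. s \<in> {1..k} \<Longrightarrow> n s > 0" and mono: "mono_on {1..k} n"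
    and k: "k = L + M"
    and count: "\<And>x. cover_count k a n (int x) + of_bool (int x \<in> residue_class b (2 ^ L)) = Suc M"
    and s: "s \<in> {1..k}"
  shows "n s = 2 ^ (s - M)"
proof -
  define T :: nat where "T = 2 ^ L"
  define q where "q = (\<Prod>s\<in>{1..k}. n s)"
  \<comment> \<open>\<open>N\<close> is a common multiple of all \<open>n s\<close> and of
    \<open>T\<close>, so every class involved is periodic modulo \<open>N\<close>.\<close>
  define N where "N = T * q"
  define d where "d s = N div n s" for s
  define l where "l x = [:1, - unit_root N (int x):]" for x
  have T: "T > 0" by (simp add: T_def)
  have q: "q > 0" unfolding q_def by (rule prod_pos) (use n in auto)
  have N: "N > 0" using T q by (simp add: N_def)
  have nd: "n s * d s = N" if "s \<in> {1..k}" for s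
    using that unfolding d_def N_def q_def by (simp add: dvd_prodI)
  have d: "d s > 0" if "s \<in> {1..k}" for s
    using nd[OF that] N by (metis gr0I mult_0_right)
  let ?P = "\<Prod>s=1..k. 1 - monom (unit_root (n s) (a s)) (d s)"
  let ?e = "unit_root T b"
  have "?P = (\<Prod>s=1..k. \<Prod>x\<in>{x \<in> {..<N}. int x \<in> residue_class (a s) (n s)}. l x)"
  proof (rule prod.cong[OF refl])
    fix s assume "s \<in> {1..k}"
    from prod_linear_residue_class[OF n[OF this] d[OF this], of "a s", unfolded nd[OF this]]
    show "1 - monom (unit_root (n s) (a s)) (d s)
        = (\<Prod>x\<in>{x \<in> {..<N}. int x \<in> residue_class (a s) (n s)}. l x)"
      by (simp add: l_def)
  qed
  \<comment> \<open>After the swap, each \<open>l x\<close> occurs once for every class containing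
    \<open>x\<close>.\<close>
  also have "\<dots> = (\<Prod>x<N. \<Prod>s\<in>{s \<in> {1..k}. int x \<in> residue_class (a s) (n s)}. l x)"
    by (rule prod.swap_restrict) simp_all
  also have "\<dots> = (\<Prod>x<N. l x ^ cover_count k a n (int x))"
    by (simp add: cover_count_def)
  finally have P: "?P = (\<Prod>x<N. l x ^ cover_count k a n (int x))" .
  have "1 - monom ?e q = (\<Prod>x\<in>{x \<in> {..<N}. int x \<in> residue_class b T}. l x)"
    using prod_linear_residue_class[OF T q, of b] by (simp add: N_def l_def)
  also have "\<dots> = (\<Prod>x<N. l x ^ of_bool (int x \<in> residue_class b T))"
    by (subst prod.inter_filter) (auto intro!: prod.cong)
  finally have P0: "1 - monom ?e q = (\<Prod>x<N. l x ^ of_bool (int x \<in> residue_class b T))" .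
  have all: "(\<Prod>x<N. l x) = 1 - monom 1 N"
    using prod_linear_residue_class[of 1 N 0] N
    by (simp add: l_def mem_residue_class_iff unit_root_def lessThan_def)
  \<comment> \<open>By \<open>count\<close>, the missing class raises every multiplicity to
    \<open>Suc M\<close>; its factor is cancelled afterwards.\<close>
  have "?P * (1 - monom ?e q) = (1 - monom 1 N) ^ Suc M"
    unfolding P P0 all[symmetric] prod.distrib[symmetric] power_add[symmetric] prod_power_distrib
    using count by (simp add: T_def)
  also have "\<dots> = ((1 - monom 1 N) ^ M * (\<Sum>r<T. monom (?e ^ r) (q * r))) * (1 - monom ?e q)"
  proof -
    have "?e ^ T = 1" using unit_root_eq_1_iff[OF T] by (simp add: unit_root_power)
    then have "1 - monom 1 N = (1 - monom ?e q) * (\<Sum>r<T. monom (?e ^ r) (q * r))"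
      using one_diff_power_eq[of "monom ?e q" T] by (simp add: monom_power N_def mult.commute)
    then show ?thesis by (simp add: mult_ac)
  qed
  finally have "?P * (1 - monom ?e q) = \<dots>" .
  moreover have "1 - monom ?e q \<noteq> 0"
  proof
    assume "1 - monom ?e q = 0"
    then have "coeff (1 - monom ?e q) 0 = 0" by simp
    then show False using q by simp
  qed
  ultimately have PQ: "?P = (1 - monom 1 N) ^ M * (\<Sum>r<T. monom (?e ^ r) (q * r))" by simp
  \<comment> \<open>The index is reversed because \<open>d\<close> decreases as \<open>n\<close>
    grows. \<open>E\<close> lists the exponents of the other side: \<open>q * 2 ^ i\<close> for
    \<open>i < L\<close>, then \<open>N\<close> repeated \<open>M\<close> times.\<close>
  define D where "D i = d (k - i)" for i
  define E where "E i = q * 2 ^ min i L" for i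
  have H: "(1 + monom 1 N) ^ M * (\<Sum>r<T. monom 1 (q * r)) = (\<Prod>i<k. 1 + monom 1 (E i) :: real poly)"
  proof -
    have "(\<Prod>i<k. 1 + monom 1 (E i) :: real poly)
        = (\<Prod>i<L. 1 + monom 1 (q * 2 ^ i)) * (\<Prod>i=L..<k. 1 + monom 1 N)"
    proof -
      have "(\<Prod>i<k. 1 + monom 1 (E i) :: real poly)
        = (\<Prod>i<L. 1 + monom 1 (E i)) * (\<Prod>i=L..<k. 1 + monom 1 (E i))"
        using prod.atLeastLessThan_concat[of 0 L k "\<lambda>i. 1 + monom 1 (E i) :: real poly"] k
        by (simp add: atLeast0LessThan)
      also have "(\<Prod>i<L. 1 + monom 1 (E i) :: real poly) = (\<Prod>i<L. 1 + monom 1 (q * 2 ^ i))"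
        by (rule prod.cong) (simp_all add: E_def)
      also have "(\<Prod>i=L..<k. 1 + monom 1 (E i) :: real poly) = (\<Prod>i=L..<k. 1 + monom 1 N)"
        by (rule prod.cong) (simp_all add: E_def N_def T_def min_absorb2 mult.commute)
      finally show ?thesis .
    qed
    then show ?thesis unfolding prod_one_plus_monom_two_power T_def[symmetric] by (simp add: k)
  qed
  have G: "(\<Prod>s=1..k. 1 + monom 1 (d s)) = (\<Prod>i<k. 1 + monom 1 (D i) :: real poly)"
    by (rule prod.reindex_bij_witness[of _ "\<lambda>i. k - i" "\<lambda>s. k - s"]) (auto simp: D_def)
  have GH: "(\<Prod>i<k. 1 + monom 1 (E i)) = (\<Prod>i<k. 1 + monom 1 (D i) :: real poly)"
  proof (rule poly_eq_if_coeff_le)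
    fix t
    have "coeff (\<Prod>i<k. 1 + monom 1 (E i) :: real poly) t = norm (coeff ?P t)"
      unfolding PQ H[symmetric] N_def
      by (rule norm_coeff_power_mult_geometric[symmetric]) (simp_all add: q T)
    also have "\<dots> \<le> coeff (\<Prod>i<k. 1 + monom 1 (D i) :: real poly) t"
      unfolding G[symmetric] by (rule coeff_prod_one_minus_monom_majorant) simp_all
    finally show "coeff (\<Prod>i<k. 1 + monom 1 (E i) :: real poly) t \<le> \<dots>" .
  qed (simp add: poly_prod poly_monom)
  \<comment> \<open>The identity moves to complex coefficients because comparing exponents uses
    complex roots.\<close>
  have "(\<Prod>i<k. 1 + monom 1 (E i)) = (\<Prod>i<k. 1 + monom 1 (D i) :: complex poly)"
  proof -
    have hom: "map_poly complex_of_real (\<Prod>i<k. 1 + monom 1 (F i)) = (\<Prod>i<k. 1 + monom 1 (F i))" for F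
    proof (induction k)
      case (Suc k)
      have "map_poly complex_of_real (p * r) = map_poly of_real p * map_poly of_real r" for p r
        by (rule poly_eqI) (simp add: coeff_map_poly coeff_mult)
      moreover have "map_poly complex_of_real (1 + monom 1 (F k)) = 1 + monom 1 (F k)"
        by (rule poly_eqI) (simp add: coeff_map_poly coeff_1)
      ultimately show ?case using Suc by simp
    qed simp
    show ?thesis using arg_cong[OF GH, of "map_poly complex_of_real"] unfolding hom .
  qed
  then have "\<forall>i<k. E i = D i"
  proof (rule prod_one_plus_monom_sorted_inject)
    show "mono_on {..<k} E" by (auto simp: mono_on_def E_def intro!: power_increasing)
    show "mono_on {..<k} D"
      unfolding D_def d_def
      by (intro mono_onI div_le_mono2 n mono_onD[OF mono]) auto
    show "E i > 0" for i using q by (simp add: E_def)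
    show "D i > 0" if "i < k" for i using that by (simp add: D_def d)
  qed
  then have "E (k - s) = D (k - s)" using s by auto
  then have "d s = q * 2 ^ min (k - s) L" using s by (simp add: E_def D_def)
  then have "n s * 2 ^ min (k - s) L = 2 ^ L" using nd[OF s] q by (simp add: N_def T_def)
  \<comment> \<open>For \<open>s < M\<close> the truncated \<open>s - M\<close> is 0 and the minimum
    is \<open>L\<close>; otherwise the minimum is \<open>k - s\<close>.\<close>
  also have "(2::nat) ^ L = 2 ^ (s - M) * 2 ^ min (k - s) L"
    unfolding power_add[symmetric] using s k by (intro arg_cong[of _ _ "power 2"]) auto
  finally show ?thesis by simp
qed

section \<open>The bound and its equality case\<close>

theorem theorem1p2:
  fixes m k :: nat and a :: "nat \<Rightarrow> int" and n :: "nat \<Rightarrow> nat"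
  assumes "m > 0" and "k > 0" and "k \<ge> m"
    and "\<And>s. s \<in> {1..k} \<Longrightarrow> n s > 0"
    and "mono_on {1..k} n"
    and "m_system m k a n"
    and "(\<Sum>s=1..k. 1 / real (n s)) \<noteq> real m"
  shows "(\<Sum>s=1..k. 1 / real (n s)) \<le> real m - 1 / 2 ^ (k - m + 1) \<and>
    ((\<Sum>s=1..k. 1 / real (n s)) = real m - 1 / 2 ^ (k - m + 1) \<longleftrightarrow>
      (\<forall>s\<in>{1..k}. n s = 2 ^ nat (max (int s - int m + 1) 0)))"
proof -
  define \<sigma> where "\<sigma> = (\<Sum>s=1..k. 1 / real (n s))"
  define L where "L = k - m + 1"
  define T :: nat where "T = 2 ^ L"
  define q where "q = (\<Prod>s\<in>{1..k}. n s)"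
  \<comment> \<open>The deficiency; the subtraction never truncates, since the system is an
    \<open>m\<close>-system.\<close>
  define g where "g x = m - cover_count k a n x" for x
  define S where "S y = (\<Sum>j<T. g (y + int j))" for y
  have T: "T > 0" by (simp add: T_def)
  have q: "q > 0" unfolding q_def by (rule prod_pos) (use assms(4) in auto)
  have dvd: "n s dvd q * T" if "s \<in> {1..k}" for s
    using that unfolding q_def by (intro dvd_mult2 dvd_prodI) auto
  have le: "cover_count k a n x \<le> m" for x
    using assms(6) by (simp add: m_system_def cover_count_def)
  have total: "real (\<Sum>x<q * T. g (y + int x)) = real (q * T) * (real m - \<sigma>)" for y
  proof -
    have "real (\<Sum>x<q * T. g (y + int x)) + real (\<Sum>x<q * T. cover_count k a n (y + int x))
        = real (q * T) * real m"
      unfolding of_nat_add[symmetric] sum.distrib[symmetric] g_def using le by simp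
    then show ?thesis
      using sum_cover_count[where n = n and k = k and a = a and y = y, OF assms(4) dvd]
      unfolding \<sigma>_def right_diff_distrib by linarith
  qed
  \<comment> \<open>A window without deficiency would leave none at any later point, so the average
    would give \<open>\<sigma> = m\<close>, which is excluded.\<close>
  have S_pos: "S y \<ge> 1" for y
  proof (rule ccontr)
    assume "\<not> ?thesis"
    then have "S y = 0" by simp
    then have "\<And>x. x < T \<Longrightarrow> g (y + int x) = 0" by (simp add: S_def)
    then have "\<And>x. x < 2 ^ (k - m + 1) \<Longrightarrow> cover_count k (\<lambda>s. a s - y) n (int x) \<ge> m"
      by (simp add: cover_count_shift g_def T_def L_def)
    from cover_count_ge_if_initial_segment[where a = "\<lambda>s. a s - y", OF assms(1,3,4) this]
    have "g (y + int x) = 0" for x by (simp add: cover_count_shift g_def)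
    then have "real m - \<sigma> = 0" using total[of y] T q by simp
    then show False using assms(7) by (simp add: \<sigma>_def)
  qed
  have windows: "(\<Sum>x<q * T. g (y + int x)) = (\<Sum>i<q. S (y + int (i * T)))" for y
  proof -
    have "S (y + int (i * T)) = (\<Sum>x\<in>{i * T..<i * T + T}. g (y + int x))" for i
      unfolding S_def
      by (rule sum.reindex_bij_witness[of _ "\<lambda>x. x - i * T" "\<lambda>j. i * T + j"])
         (auto simp: algebra_simps)
    then show ?thesis by (simp add: sum.nat_group)
  qed
  have "q \<le> (\<Sum>i<q. S (0 + int (i * T)))"
    using sum_mono[of "{..<q}" "\<lambda>_. 1" "\<lambda>i. S (0 + int (i * T))"] S_pos by simp
  then have "real q \<le> real (q * T) * (real m - \<sigma>)"
    unfolding windows[symmetric] total[of 0, symmetric] of_nat_le_iff .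
  then have "real q * 1 \<le> real q * (real T * (real m - \<sigma>))" 
    by (simp only: of_nat_mult mult_1_right mult.assoc)
  then have "1 \<le> real T * (real m - \<sigma>)" using q by (simp only: mult_le_cancel_left)
  then have ineq: "\<sigma> \<le> real m - 1 / real T"
    using T by (simp add: field_simps)
  have moduli: "n s = 2 ^ (s - (m - 1))" if eq: "\<sigma> = real m - 1 / real T" and s: "s \<in> {1..k}" for s
  proof -
    \<comment> \<open>In the equality case the \<open>q\<close> windows, each contributing at least
      1, have total exactly \<open>q\<close>. As \<open>y\<close> is arbitrary, it suffices to look
      at the first of them.\<close>
    have S1: "S y = 1" for y
    proof -
      have "real (\<Sum>i<q. S (y + int (i * T))) = real q"
        using total[of y] T unfolding windows eq by simp
      then have "(\<Sum>i<q. 1) = (\<Sum>i<q. S (y + int (i * T)))"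
        unfolding of_nat_eq_iff by (simp only: sum_constant card_lessThan) simp
      from sum_mono_inv[OF this S_pos, of 0] show ?thesis using q by simp
    qed
    \<comment> \<open>Adjacent windows differ only in their end points and have equal sums.\<close>
    have period: "g (y + int T) = g y" for y
    proof -
      have "S y + g (y + int T) = (\<Sum>j<Suc T. g (y + int j))" by (simp add: S_def)
      also have "\<dots> = g y + S (y + 1)"
        unfolding sum.lessThan_Suc_shift S_def by (simp add: algebra_simps)
      finally show ?thesis using S1 by simp
    qed
    have g_mod: "g (int x) = g (int (x mod T))" for x
    proof (induction x rule: less_induct)
      case (less x)
      show ?case
      proof (cases "x < T")
        case False
        then have "g (int x) = g (int (x - T))" using period[of "int (x - T)"] by simp
        also have "\<dots> = g (int (x mod T))" using less[of "x - T"] False T by (simp add: le_mod_geq)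
        finally show ?thesis .
      qed simp
    qed
    obtain b where b: "b < T" "g (int b) = 1" "\<And>c. c < T \<Longrightarrow> b \<noteq> c \<Longrightarrow> g (int c) = 0"
      using S1[of 0] unfolding S_def sum_eq_1_iff[OF finite_lessThan] by auto
    have "cover_count k a n (int x) + of_bool (int x \<in> residue_class (int b) (2 ^ L)) = Suc (m - 1)" for x
    proof -
      have "int x \<in> residue_class (int b) (2 ^ L) \<longleftrightarrow> x mod T = b"
        using b(1) cong_int_iff[of x b T] unfolding T_def residue_class_def by (simp add: cong_def)
      moreover have "g (int x) = of_bool (x mod T = b)"
        using g_mod[of x] b T by (cases "x mod T = b") auto
      ultimately show ?thesis using le[of "int x"] assms(1) by (auto simp: g_def split: if_splits)
    qed
    moreover have "k = L + (m - 1)" using assms(1,3) by (simp add: L_def)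
    ultimately show ?thesis
      using moduli_of_cover_missing_two_power_class[OF assms(4,5)] s by blast
  qed
  have sum: "\<sigma> = real m - 1 / real T" if "\<forall>s\<in>{1..k}. n s = 2 ^ (s - (m - 1))"
  proof -
    \<comment> \<open>The first \<open>m - 1\<close> terms are 1 because the exponent truncates to
      0; the others form a geometric series.\<close>
    have geo: "(\<Sum>s=1..m - 1 + j. 1 / 2 ^ (s - (m - 1))) = real m - 1 / 2 ^ j" for j
    proof (induction j)
      case 0
      then show ?case using assms(1) by (simp add: of_nat_diff)
    next
      case (Suc j)
      then show ?case by (simp add: field_simps)
    qed
    have "\<sigma> = (\<Sum>s=1..m - 1 + L. 1 / 2 ^ (s - (m - 1)))"
      unfolding \<sigma>_def using that assms(1,3) by (intro sum.cong) (auto simp: L_def)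
    then show ?thesis using geo[of L] by (simp add: T_def)
  qed
  have expo: "nat (max (int s - int m + 1) 0) = s - (m - 1)" for s
    using assms(1) by auto
  have T_real: "2 ^ (k - m + 1) = real T" by (simp add: T_def L_def)
  show ?thesis
    unfolding expo T_real \<sigma>_def[symmetric] using ineq moduli sum by blast
qed

end
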